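(* Let $\xi$ be an all-small position with $\xi\neq 0$. Then $*+*\equiv 0\pmod{\mathrm{cl}(\xi)}$.
   Context: A position $\xi=\{\xi^L \mid \xi^R\}$ is given recursively by finite sets of Left and Right options; $0=\{\cdot\mid\cdot\}$, $*=\{0\mid 0\}$. A position is all-small if Left can move in it iff Right can, and every option is all-small. Disjunctive sum: $\alpha+\beta=\{\alpha^L+\beta,\alpha+\beta^L \mid \alpha^R+\beta,\alpha+\beta^R\}$. Under misère play a player unable to move on their turn wins; $o^-(\xi)\in\{\mathcal{L},\mathcal{R},\mathcal{N},\mathcal{P}\}$ is the misère outcome (Left wins always / Right wins always / next player wins / next player loses). $\mathrm{cl}(\Upsilon)$ is the smallest set containing $\Upsilon$ closed under disjunctive sum and taking options. For a closed set $\Gamma$ and $\alpha,\beta\in\Gamma$, $\alpha\equiv\beta\pmod\Gamma$ means $o^-(\alpha+\gamma)=o^-(\beta+\gamma)$ for all $\gamma\in\Gamma$. *)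

theory Defs
  imports Main "HOL-Library.FSet"
begin

datatype position = Pos (left_opts: "position fset") (right_opts: "position fset")

datatype player = Left | Right

primrec opponent :: "player \<Rightarrow> player" where
  "opponent Left = Right"
| "opponent Right = Left"

primrec opts :: "player \<Rightarrow> position \<Rightarrow> position fset" where
  "opts Left \<xi> = left_opts \<xi>"
| "opts Right \<xi> = right_opts \<xi>"

lemma size_left_opt: "\<eta> |\<in>| left_opts \<xi> \<Longrightarrow> size \<eta> < size \<xi>"
proof (cases \<xi>)
  case (Pos l r)
  assume "\<eta> |\<in>| left_opts \<xi>"
  then have "Suc (size \<eta>) \<le> (\<Sum>x\<in>fset l. Suc (size x))"
    using Pos member_le_sum[of \<eta> "fset l" "\<lambda>x. Suc (size x)"] by simp
  then show ?thesis using Pos by simp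
qed

lemma size_right_opt: "\<eta> |\<in>| right_opts \<xi> \<Longrightarrow> size \<eta> < size \<xi>"
proof (cases \<xi>)
  case (Pos l r)
  assume "\<eta> |\<in>| right_opts \<xi>"
  then have "Suc (size \<eta>) \<le> (\<Sum>x\<in>fset r. Suc (size x))"
    using Pos member_le_sum[of \<eta> "fset r" "\<lambda>x. Suc (size x)"] by simp
  then show ?thesis using Pos by simp
qed

lemma size_opt: "\<eta> |\<in>| opts p \<xi> \<Longrightarrow> size \<eta> < size \<xi>"
  by (cases p) (auto dest: size_left_opt size_right_opt)

definition zero_pos :: position where
  "zero_pos = Pos {||} {||}"

definition star :: position where
  "star = Pos {|zero_pos|} {|zero_pos|}"

function all_small :: "position \<Rightarrow> bool" where
  "all_small \<xi> \<longleftrightarrow>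
     (left_opts \<xi> \<noteq> {||} \<longleftrightarrow> right_opts \<xi> \<noteq> {||}) \<and>
     (\<forall>\<eta>|\<in>|left_opts \<xi>. all_small \<eta>) \<and>
     (\<forall>\<eta>|\<in>|right_opts \<xi>. all_small \<eta>)"
  by pat_completeness auto
termination
  by (relation "measure size") (auto dest: size_left_opt size_right_opt)

declare all_small.simps [simp del]

function disj_sum :: "position \<Rightarrow> position \<Rightarrow> position" (infixl "\<oplus>" 65) where
  "\<alpha> \<oplus> \<beta> = Pos
     ((\<lambda>\<alpha>'. \<alpha>' \<oplus> \<beta>) |`| left_opts \<alpha> |\<union>| (\<lambda>\<beta>'. \<alpha> \<oplus> \<beta>') |`| left_opts \<beta>)
     ((\<lambda>\<alpha>'. \<alpha>' \<oplus> \<beta>) |`| right_opts \<alpha> |\<union>| (\<lambda>\<beta>'. \<alpha> \<oplus> \<beta>') |`| right_opts \<beta>)"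
  by pat_completeness auto
termination
  by (relation "measure (\<lambda>(\<alpha>, \<beta>). size \<alpha> + size \<beta>)")
     (auto dest: size_left_opt size_right_opt)

declare disj_sum.simps [simp del]

text \<open>
  \<open>wins_first p \<xi>\<close>: player \<open>p\<close>, moving first in \<open>\<xi>\<close>, has a winning strategy under misere play.
  Play is finite and has no draws, so \<open>p\<close> wins moving second iff the opponent does not win
  moving first.
\<close>

function wins_first :: "player \<Rightarrow> position \<Rightarrow> bool" where
  "wins_first p \<xi> \<longleftrightarrow>
     opts p \<xi> = {||} \<or> (\<exists>\<eta>|\<in>|opts p \<xi>. \<not> wins_first (opponent p) \<eta>)"
  by pat_completeness auto
termination
  by (relation "measure (\<lambda>(p, \<xi>). size \<xi>)") (auto dest: size_opt)

declare wins_first.simps [simp del]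

datatype outcome = \<L> | \<R> | \<N> | \<P>

definition misere_outcome :: "position \<Rightarrow> outcome" where
  "misere_outcome \<xi> =
     (if wins_first Left \<xi>
      then (if wins_first Right \<xi> then \<N> else \<L>)
      else (if wins_first Right \<xi> then \<R> else \<P>))"

inductive_set cl :: "position set \<Rightarrow> position set" for \<Upsilon> :: "position set" where
  base: "\<xi> \<in> \<Upsilon> \<Longrightarrow> \<xi> \<in> cl \<Upsilon>"
| sum: "\<alpha> \<in> cl \<Upsilon> \<Longrightarrow> \<beta> \<in> cl \<Upsilon> \<Longrightarrow> \<alpha> \<oplus> \<beta> \<in> cl \<Upsilon>"
| left: "\<xi> \<in> cl \<Upsilon> \<Longrightarrow> \<eta> |\<in>| left_opts \<xi> \<Longrightarrow> \<eta> \<in> cl \<Upsilon>"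
| right: "\<xi> \<in> cl \<Upsilon> \<Longrightarrow> \<eta> |\<in>| right_opts \<xi> \<Longrightarrow> \<eta> \<in> cl \<Upsilon>"

text \<open>
  The relation is only meaningful between members of \<open>\<Gamma>\<close>, so membership of both sides is part of it.
\<close>

definition equiv_mod :: "position \<Rightarrow> position \<Rightarrow> position set \<Rightarrow> bool" where
  "equiv_mod \<alpha> \<beta> \<Gamma> \<longleftrightarrow>
     \<alpha> \<in> \<Gamma> \<and> \<beta> \<in> \<Gamma> \<and>
     (\<forall>\<gamma>\<in>\<Gamma>. misere_outcome (\<alpha> \<oplus> \<gamma>) = misere_outcome (\<beta> \<oplus> \<gamma>))"

end

theory Submission
  imports Defs
begin

text \<open>
  Suppose every move in \<open>\<delta>\<close> can be answered by a move to \<open>0\<close>, and the first player wins \<open>\<delta>\<close> by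
  itself. Adding \<open>\<delta>\<close> to an all-small \<open>\<gamma>\<close> then does not change who wins: the winner of \<open>\<gamma>\<close> plays as
  before and answers any move in \<open>\<delta>\<close> by a move to \<open>0\<close>. All-smallness matters at the end of play,
  when a player cannot move in \<open>\<gamma>\<close>: then \<open>\<gamma> = 0\<close>, and that player still wins because only \<open>\<delta>\<close> is
  left. This applies to \<open>\<delta> = * + *\<close>. Finally \<open>*\<close> belongs to \<open>cl(\<xi>)\<close> because a minimal nonzero
  subposition of \<open>\<xi>\<close> has \<open>0\<close> as its only option on both sides.
\<close>

declare opts.simps [simp del]

lemma all_player_iff: "(\<forall>p. P p) \<longleftrightarrow> P Left \<and> P Right"
  by (metis player.exhaust)

lemma opponent_opponent [simp]: "opponent (opponent p) = p"
  by (cases p) simp_all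

lemma position_eqI:
  assumes "\<And>p. opts p \<alpha> = opts p \<beta>"
  shows "\<alpha> = \<beta>"
  using assms[of Left] assms[of Right] by (simp add: opts.simps position.expand)

lemma position_opts_induct [case_names opts]:
  assumes "\<And>\<xi>. (\<And>p \<eta>. \<eta> |\<in>| opts p \<xi> \<Longrightarrow> P \<eta>) \<Longrightarrow> P \<xi>"
  shows "P \<xi>"
proof (induction \<xi> rule: measure_induct_rule[of size])
  case (less \<xi>)
  show ?case
    by (rule assms) (rule less.IH[OF size_opt])
qed

lemma position_opts_induct2 [case_names opts]:
  assumes "\<And>\<alpha> \<beta>. (\<And>p \<alpha>'. \<alpha>' |\<in>| opts p \<alpha> \<Longrightarrow> P \<alpha>' \<beta>) \<Longrightarrow>
    (\<And>p \<beta>'. \<beta>' |\<in>| opts p \<beta> \<Longrightarrow> P \<alpha> \<beta>') \<Longrightarrow> P \<alpha> \<beta>"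
  shows "P \<alpha> \<beta>"
proof (induction \<alpha> arbitrary: \<beta> rule: position_opts_induct)
  case outer: (opts \<alpha>)
  show ?case
  proof (induction \<beta> rule: position_opts_induct)
    case (opts \<beta>)
    with outer.IH show ?case
      by (rule assms)
  qed
qed

lemma opts_zero_pos [simp]: "opts p zero_pos = {||}"
  by (cases p) (simp_all add: opts.simps zero_pos_def)

lemma opts_star [simp]: "opts p star = {|zero_pos|}"
  by (cases p) (simp_all add: opts.simps star_def)

lemma opts_disj_sum:
  "opts p (\<alpha> \<oplus> \<beta>) = (\<lambda>\<alpha>'. \<alpha>' \<oplus> \<beta>) |`| opts p \<alpha> |\<union>| (\<lambda>\<beta>'. \<alpha> \<oplus> \<beta>') |`| opts p \<beta>"
  by (cases p) (simp_all add: opts.simps disj_sum.simps[of \<alpha> \<beta>])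

lemma disj_sum_commute: "\<alpha> \<oplus> \<beta> = \<beta> \<oplus> \<alpha>"
proof (induction \<alpha> \<beta> rule: position_opts_induct2)
  case (opts \<alpha> \<beta>)
  show ?case
  proof (rule position_eqI)
    fix p
    have "(\<lambda>\<alpha>'. \<alpha>' \<oplus> \<beta>) |`| opts p \<alpha> = (\<lambda>\<alpha>'. \<beta> \<oplus> \<alpha>') |`| opts p \<alpha>"
      using opts.IH(1) by (intro fset.map_cong refl)
    moreover have "(\<lambda>\<beta>'. \<alpha> \<oplus> \<beta>') |`| opts p \<beta> = (\<lambda>\<beta>'. \<beta>' \<oplus> \<alpha>) |`| opts p \<beta>"
      using opts.IH(2) by (intro fset.map_cong refl)
    ultimately show "opts p (\<alpha> \<oplus> \<beta>) = opts p (\<beta> \<oplus> \<alpha>)"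
      by (simp add: opts_disj_sum sup_commute)
  qed
qed

lemma disj_sum_zero_left [simp]: "zero_pos \<oplus> \<alpha> = \<alpha>"
proof (induction \<alpha> rule: position_opts_induct)
  case (opts \<alpha>)
  show ?case
  proof (rule position_eqI)
    fix p
    have "(\<lambda>\<alpha>'. zero_pos \<oplus> \<alpha>') |`| opts p \<alpha> = (\<lambda>\<alpha>'. \<alpha>') |`| opts p \<alpha>"
      using opts.IH by (intro fset.map_cong refl)
    then show "opts p (zero_pos \<oplus> \<alpha>) = opts p \<alpha>"
      by (simp add: opts_disj_sum)
  qed
qed

lemma disj_sum_zero_right [simp]: "\<alpha> \<oplus> zero_pos = \<alpha>"
  by (simp add: disj_sum_commute[of \<alpha>])

lemma all_small_iff_opts:
  "all_small \<xi> \<longleftrightarrow> (opts Left \<xi> = {||} \<longleftrightarrow> opts Right \<xi> = {||}) \<and>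
     (\<forall>p. \<forall>\<eta>|\<in>|opts p \<xi>. all_small \<eta>)"
  by (auto simp: all_small.simps[of \<xi>] all_player_iff opts.simps)

lemma all_small_opt: "all_small \<xi> \<Longrightarrow> \<eta> |\<in>| opts p \<xi> \<Longrightarrow> all_small \<eta>"
  by (auto simp: all_small_iff_opts[of \<xi>])

lemma all_small_opts_empty_iff:
  assumes "all_small \<xi>"
  shows "opts p \<xi> = {||} \<longleftrightarrow> \<xi> = zero_pos"
proof
  assume "opts p \<xi> = {||}"
  then have "\<forall>q. opts q \<xi> = {||}"
    using assms by (cases p) (auto simp: all_small_iff_opts[of \<xi>] all_player_iff)
  then show "\<xi> = zero_pos"
    by (intro position_eqI) simp
qed simp

lemma all_small_disj_sum:
  assumes "all_small \<alpha>" and "all_small \<beta>"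
  shows "all_small (\<alpha> \<oplus> \<beta>)"
  using assms
proof (induction \<alpha> \<beta> rule: position_opts_induct2)
  case (opts \<alpha> \<beta>)
  have "opts Left (\<alpha> \<oplus> \<beta>) = {||} \<longleftrightarrow> opts Right (\<alpha> \<oplus> \<beta>) = {||}"
    using opts.prems by (simp add: opts_disj_sum all_small_opts_empty_iff)
  moreover have "all_small \<eta>" if "\<eta> |\<in>| opts p (\<alpha> \<oplus> \<beta>)" for p \<eta>
    using that opts.IH opts.prems all_small_opt by (fastforce simp: opts_disj_sum)
  ultimately show ?case
    by (simp add: all_small_iff_opts[of "\<alpha> \<oplus> \<beta>"])
qed

definition option_closed :: "position set \<Rightarrow> bool" where
  "option_closed \<Gamma> \<longleftrightarrow> (\<forall>\<xi>\<in>\<Gamma>. \<forall>p. \<forall>\<eta>|\<in>|opts p \<xi>. \<eta> \<in> \<Gamma>)"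

lemma option_closedD: "option_closed \<Gamma> \<Longrightarrow> \<xi> \<in> \<Gamma> \<Longrightarrow> \<eta> |\<in>| opts p \<xi> \<Longrightarrow> \<eta> \<in> \<Gamma>"
  by (auto simp: option_closed_def)

lemma option_closed_cl: "option_closed (cl \<Upsilon>)"
  by (auto simp: option_closed_def all_player_iff opts.simps dest: cl.left cl.right)

lemma star_in_option_closed:
  assumes "option_closed \<Gamma>" and "\<xi> \<in> \<Gamma>" and "all_small \<xi>" and "\<xi> \<noteq> zero_pos"
  shows "star \<in> \<Gamma>"
  using assms(2-)
proof (induction \<xi> rule: position_opts_induct)
  case (opts \<xi>)
  show ?case
  proof (cases "\<exists>p. \<exists>\<eta>|\<in>|opts p \<xi>. \<eta> \<noteq> zero_pos")
    case True
    then obtain p \<eta> where \<eta>: "\<eta> |\<in>| opts p \<xi>" and nonzero: "\<eta> \<noteq> zero_pos"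
      by blast
    have "\<eta> \<in> \<Gamma>"
      using assms(1) opts.prems(1) \<eta> by (rule option_closedD)
    moreover have "all_small \<eta>"
      using opts.prems(2) \<eta> by (rule all_small_opt)
    ultimately show ?thesis
      using nonzero by (rule opts.IH[OF \<eta>])
  next
    case False
    have "opts p \<xi> = {|zero_pos|}" for p
    proof -
      have "opts p \<xi> |\<subseteq>| {|zero_pos|}"
        using False by blast
      moreover have "opts p \<xi> \<noteq> {||}"
        using opts.prems(2,3) by (simp add: all_small_opts_empty_iff)
      ultimately show ?thesis
        by (blast dest: fsubset_fsingletonD)
    qed
    then have "\<xi> = star"
      by (intro position_eqI) simp
    then show ?thesis
      using opts.prems(1) by simp
  qed
qed

lemma all_small_cl:
  assumes "\<gamma> \<in> cl \<Upsilon>" and "\<And>\<xi>. \<xi> \<in> \<Upsilon> \<Longrightarrow> all_small \<xi>"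
  shows "all_small \<gamma>"
  using assms(1)
proof induction
  case (left \<xi> \<eta>)
  then show ?case
    by (simp add: all_small.simps[of \<xi>])
next
  case (right \<xi> \<eta>)
  then show ?case
    by (simp add: all_small.simps[of \<xi>])
qed (simp_all add: assms(2) all_small_disj_sum)

lemma wins_first_zero_pos [simp]: "wins_first p zero_pos"
  by (simp add: wins_first.simps[of p zero_pos])

lemma not_wins_first_star [simp]: "\<not> wins_first p star"
  by (simp add: wins_first.simps[of p star])

lemma wins_firstI:
  assumes "\<eta> |\<in>| opts p \<xi>" and "\<not> wins_first (opponent p) \<eta>"
  shows "wins_first p \<xi>"
  using assms by (subst wins_first.simps) blast

lemma wins_first_iff_of_opts_nonempty:
  assumes "opts p \<xi> \<noteq> {||}"
  shows "wins_first p \<xi> \<longleftrightarrow> (\<exists>\<eta>|\<in>|opts p \<xi>. \<not> wins_first (opponent p) \<eta>)"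
  using assms by (simp add: wins_first.simps[of p \<xi>])

lemma wins_first_disj_sum_reversible:
  assumes reply: "\<And>p \<delta>'. \<delta>' |\<in>| opts p \<delta> \<Longrightarrow> zero_pos |\<in>| opts (opponent p) \<delta>'"
    and first_wins: "\<And>p. wins_first p \<delta>"
    and "all_small \<gamma>"
  shows "wins_first p (\<delta> \<oplus> \<gamma>) \<longleftrightarrow> wins_first p \<gamma>"
  using assms(3)
proof (induction \<gamma> arbitrary: p rule: position_opts_induct)
  case (opts \<gamma>)
  show ?case
  proof (cases "\<gamma> = zero_pos")
    case True
    then show ?thesis
      by (simp add: first_wins)
  next
    case False
    then have nonempty: "opts p \<gamma> \<noteq> {||}"
      using all_small_opts_empty_iff[OF opts.prems] by simp
    have move_in_\<delta>: "wins_first (opponent p) (\<delta>' \<oplus> \<gamma>)"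
      if "\<not> wins_first p \<gamma>" and "\<delta>' |\<in>| opts p \<delta>" for \<delta>'
    proof (rule wins_firstI)
      show "\<gamma> |\<in>| opts (opponent p) (\<delta>' \<oplus> \<gamma>)"
        using reply[OF that(2)] by (force simp: opts_disj_sum)
    qed (simp add: that(1))
    have move_in_\<gamma>: "wins_first (opponent p) (\<delta> \<oplus> \<gamma>') \<longleftrightarrow> wins_first (opponent p) \<gamma>'"
      if "\<gamma>' |\<in>| opts p \<gamma>" for \<gamma>'
      using opts.IH[OF that] all_small_opt[OF opts.prems that] .
    have "wins_first p (\<delta> \<oplus> \<gamma>) \<longleftrightarrow>
        (\<exists>\<delta>'|\<in>|opts p \<delta>. \<not> wins_first (opponent p) (\<delta>' \<oplus> \<gamma>)) \<or>
        (\<exists>\<gamma>'|\<in>|opts p \<gamma>. \<not> wins_first (opponent p) (\<delta> \<oplus> \<gamma>'))"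
      using nonempty by (subst wins_first_iff_of_opts_nonempty) (auto simp: opts_disj_sum)
    also have "\<dots> \<longleftrightarrow>
        (\<exists>\<delta>'|\<in>|opts p \<delta>. \<not> wins_first (opponent p) (\<delta>' \<oplus> \<gamma>)) \<or> wins_first p \<gamma>"
      by (simp add: move_in_\<gamma> wins_first_iff_of_opts_nonempty[OF nonempty] cong: fBex_cong)
    also have "\<dots> \<longleftrightarrow> wins_first p \<gamma>"
      using move_in_\<delta> by blast
    finally show ?thesis .
  qed
qed

lemma opts_star_star: "opts p (star \<oplus> star) = {|star|}"
  by (simp add: opts_disj_sum)

lemma wins_first_star_star_disj_sum:
  assumes "all_small \<gamma>"
  shows "wins_first p (star \<oplus> star \<oplus> \<gamma>) \<longleftrightarrow> wins_first p \<gamma>"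
proof (rule wins_first_disj_sum_reversible)
  show "wins_first q (star \<oplus> star)" for q
    by (rule wins_firstI[where \<eta> = star]) (simp_all add: opts_star_star)
qed (simp_all add: assms opts_star_star)

lemma misere_outcome_eqI:
  assumes "\<And>p. wins_first p \<alpha> \<longleftrightarrow> wins_first p \<beta>"
  shows "misere_outcome \<alpha> = misere_outcome \<beta>"
  by (simp add: misere_outcome_def assms)

lemma star_star_equiv_mod_zero_cl:
  assumes "\<And>\<xi>. \<xi> \<in> \<Upsilon> \<Longrightarrow> all_small \<xi>" and "\<xi> \<in> \<Upsilon>" and "\<xi> \<noteq> zero_pos"
  shows "equiv_mod (star \<oplus> star) zero_pos (cl \<Upsilon>)"
  unfolding equiv_mod_def
proof (intro conjI ballI)
  have star: "star \<in> cl \<Upsilon>"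
    using option_closed_cl cl.base[OF assms(2)] assms(1)[OF assms(2)] assms(3)
    by (rule star_in_option_closed)
  then show "star \<oplus> star \<in> cl \<Upsilon>"
    by (intro cl.sum)
  show "zero_pos \<in> cl \<Upsilon>"
    using option_closed_cl star by (rule option_closedD[where p = Left]) simp
  fix \<gamma>
  assume "\<gamma> \<in> cl \<Upsilon>"
  then have "all_small \<gamma>"
    using assms(1) by (rule all_small_cl)
  then have "wins_first p (star \<oplus> star \<oplus> \<gamma>) \<longleftrightarrow> wins_first p (zero_pos \<oplus> \<gamma>)" for p
    by (simp add: wins_first_star_star_disj_sum)
  then show "misere_outcome (star \<oplus> star \<oplus> \<gamma>) = misere_outcome (zero_pos \<oplus> \<gamma>)"
    by (rule misere_outcome_eqI)
qed

theorem theorem4p2p2: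
  fixes \<xi> :: position
  assumes "all_small \<xi>"
    and "\<xi> \<noteq> zero_pos"
  shows "equiv_mod (star \<oplus> star) zero_pos (cl {\<xi>})"
  using assms by (intro star_star_equiv_mod_zero_cl[of "{\<xi>}" \<xi>]) simp_all

end
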